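(* If a point $D\in\mathbb{R}^3\setminus\{A,B,C\}$ is degenerate for the map $F$, then either $D\in\Pi^0$ or $D\in\mathrm{Cyl}$, where $\Pi^0$ is the plane $ABC$ and $\mathrm{Cyl}$ is the right cylinder over the circle circumscribed around the triangle $ABC$.
   Context: $ABC$ is a non-degenerate triangle in $\mathbb{R}^3$ lying in the plane $\Pi^0=\{(p,q,0)\}$. For $D\in\mathbb{R}^3\setminus\{A,B,C\}$, $F(D)=(F_1,F_2,F_3)(D)=(\cos\angle BDC,\cos\angle ADC,\cos\angle ADB)$. A point $D$ is degenerate for $F$ if the linear span of the gradients $\nabla F_1,\nabla F_2,\nabla F_3$ at $D$ (with respect to the Cartesian coordinates of $D$) is not $3$-dimensional. $\mathrm{Cyl}=S\times(-\infty,\infty)$, where $S\subset\Pi^0$ is the circumscribed circle of $ABC$. *)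

theory Defs
  imports "HOL-Analysis.Analysis"
begin

text \<open>The angle $PQR$ at the vertex $Q$; it is meaningful for $P \neq Q$ and $R \neq Q$.\<close>

definition angle :: "real^3 \<Rightarrow> real^3 \<Rightarrow> real^3 \<Rightarrow> real" where
  "angle P Q R = arccos (((P - Q) \<bullet> (R - Q)) / (norm (P - Q) * norm (R - Q)))"

definition F :: "real^3 \<Rightarrow> real^3 \<Rightarrow> real^3 \<Rightarrow> real^3 \<Rightarrow> real^3" where
  "F A B C D = vector [cos (angle B D C), cos (angle A D C), cos (angle A D B)]"

text \<open>The gradient is the unique vector singled out by the library relation \<open>GDERIV\<close>; it is
  unspecified where the function is not differentiable.  The lemma \<open>F_differentiable\<close> below shows
  that this does not concern \<open>F\<close> outside its three singular points.\<close>

definition gradient :: "('a::real_inner \<Rightarrow> real) \<Rightarrow> 'a \<Rightarrow> 'a" where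
  "gradient f x = (THE g. GDERIV f x :> g)"

definition degenerate_for_F :: "real^3 \<Rightarrow> real^3 \<Rightarrow> real^3 \<Rightarrow> real^3 \<Rightarrow> bool" where
  "degenerate_for_F A B C D \<longleftrightarrow>
     dim (span {gradient (\<lambda>X. F A B C X $ 1) D,
                gradient (\<lambda>X. F A B C X $ 2) D,
                gradient (\<lambda>X. F A B C X $ 3) D}) \<noteq> 3"

definition Pi0 :: "(real^3) set" where
  "Pi0 = {X. X $ 3 = 0}"

definition circumcenter :: "real^3 \<Rightarrow> real^3 \<Rightarrow> real^3 \<Rightarrow> real^3" where
  "circumcenter A B C = (THE Z. Z \<in> Pi0 \<and> dist Z A = dist Z B \<and> dist Z A = dist Z C)"

definition circumcircle :: "real^3 \<Rightarrow> real^3 \<Rightarrow> real^3 \<Rightarrow> (real^3) set" where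
  "circumcircle A B C =
     {X \<in> Pi0. dist (circumcenter A B C) X = dist (circumcenter A B C) A}"

definition Cyl :: "real^3 \<Rightarrow> real^3 \<Rightarrow> real^3 \<Rightarrow> (real^3) set" where
  "Cyl A B C = {X + t *\<^sub>R axis 3 1 | X t. X \<in> circumcircle A B C}"

lemma gradient_eqI:
  fixes f :: "'a::real_inner \<Rightarrow> real"
  assumes "GDERIV f x :> g"
  shows "gradient f x = g"
  unfolding gradient_def
proof (rule the_equality)
  show "GDERIV f x :> g" by (rule assms)
next
  fix h assume "GDERIV f x :> h"
  with assms have "(\<lambda>y. y \<bullet> h) = (\<lambda>y. y \<bullet> g)"
    unfolding gderiv_def by (metis has_derivative_unique)
  then have "(h - g) \<bullet> h = (h - g) \<bullet> g" by metis
  then have "(h - g) \<bullet> (h - g) = 0" by (simp add: inner_diff_right)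
  then show "h = g" by simp
qed

lemma GDERIV_gradient:
  fixes f :: "'a::euclidean_space \<Rightarrow> real"
  assumes "f differentiable (at x)"
  shows "GDERIV f x :> gradient f x"
proof -
  from assms obtain f' where f': "(f has_derivative f') (at x)"
    unfolding differentiable_def by blast
  interpret bounded_linear f' using f' by (rule has_derivative_bounded_linear)
  have "f' h = h \<bullet> (\<Sum>b\<in>Basis. f' b *\<^sub>R b)" for h
  proof -
    have "f' h = f' (\<Sum>b\<in>Basis. (h \<bullet> b) *\<^sub>R b)" by (simp add: euclidean_representation)
    also have "\<dots> = (\<Sum>b\<in>Basis. (h \<bullet> b) * f' b)" by (simp add: sum scaleR)
    finally show ?thesis by (simp add: inner_sum_right mult.commute)
  qed
  then have "f' = (\<lambda>h. h \<bullet> (\<Sum>b\<in>Basis. f' b *\<^sub>R b))" by blast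
  with f' have "GDERIV f x :> (\<Sum>b\<in>Basis. f' b *\<^sub>R b)" by (metis gderiv_def)
  then show ?thesis using gradient_eqI by metis
qed

lemma cos_angle:
  "cos (angle P Q R) = ((P - Q) \<bullet> (R - Q)) / (norm (P - Q) * norm (R - Q))"
proof -
  have "\<bar>((P - Q) \<bullet> (R - Q)) / (norm (P - Q) * norm (R - Q))\<bar> \<le> 1"
    using Cauchy_Schwarz_ineq2[of "P - Q" "R - Q"] by (auto simp: divide_le_eq_1 abs_mult)
  then show ?thesis unfolding angle_def by (intro cos_arccos_abs)
qed

lemma F_differentiable:
  assumes "D \<notin> {A, B, C}"
  shows "(\<lambda>X. F A B C X $ i) differentiable (at D)"
proof -
  have *: "(\<lambda>X. cos (angle P X R)) differentiable (at D)"
    if "D \<noteq> P" "D \<noteq> R" for P R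
  proof -
    have n: "(\<lambda>X. norm (Q - X)) differentiable (at D)" if "D \<noteq> Q" for Q :: "real^3"
      using differentiable_compose[of norm "\<lambda>X. Q - X" D UNIV] differentiable_norm_at[of "Q - D"] that
      by (auto intro: differentiable_at_withinI)
    have i: "(\<lambda>X. (P - X) \<bullet> (R - X)) differentiable (at D)"
      by (intro derivative_intros differentiable_inner)
    show ?thesis unfolding cos_angle
      using that by (intro differentiable_divide differentiable_mult n i) auto
  qed
  consider "i = 1" | "i = 2" | "i = 3" using exhaust_3 by blast
  then show ?thesis using assms by cases (auto simp: F_def intro!: *)
qed

lemma circumcenter_ex1:
  assumes "A \<in> Pi0" "B \<in> Pi0" "C \<in> Pi0" "\<not> collinear {A, B, C}"
  shows "\<exists>!Z. Z \<in> Pi0 \<and> dist Z A = dist Z B \<and> dist Z A = dist Z C"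
proof -
  define b1 b2 c1 c2 where
    "b1 = B $ 1 - A $ 1" and "b2 = B $ 2 - A $ 2" and "c1 = C $ 1 - A $ 1" and "c2 = C $ 2 - A $ 2"
  note d = b1_def b2_def c1_def c2_def
  define k where "k = b1 * c2 - b2 * c1"
  have z: "A $ 3 = 0" "B $ 3 = 0" "C $ 3 = 0" using assms by (auto simp: Pi0_def)
  have k: "k \<noteq> 0"
  proof
    assume k0: "k = 0"
    have "collinear {A, B, C}"
    proof (cases "B = A")
      case True then show ?thesis by simp
    next
      case False
      then have nz: "b1 \<noteq> 0 \<or> b2 \<noteq> 0"
        using z by (auto simp: d vec_eq_iff forall_3)
      define t where "t = (if b1 \<noteq> 0 then c1 / b1 else c2 / b2)"
      have "c1 = t * b1" "c2 = t * b2"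
        using k0 nz by (auto simp: k_def t_def field_simps)
      then have "C - A = t *\<^sub>R (B - A)"
        using z by (simp add: d vec_eq_iff forall_3)
      then have "collinear {0, B - A, C - A}" by (metis collinear_lemma)
      then have "collinear {B, A, C}" by (subst collinear_3) (simp add: insert_commute)
      then show ?thesis by (simp add: insert_commute)
    qed
    with assms show False by blast
  qed
  define p q where "p = (b1\<^sup>2 + b2\<^sup>2) / 2" and "q = (c1\<^sup>2 + c2\<^sup>2) / 2"
  have eq: "Z \<in> Pi0 \<and> dist Z A = dist Z B \<and> dist Z A = dist Z C \<longleftrightarrow>
      Z $ 3 = 0 \<and> Z $ 1 - A $ 1 = (p * c2 - q * b2) / k \<and> Z $ 2 - A $ 2 = (q * b1 - p * c1) / k"
    for Z :: "real^3"
  proof -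
    define x y where "x = Z $ 1 - A $ 1" and "y = Z $ 2 - A $ 2"
    have "dist Z A = dist Z B \<longleftrightarrow> b1 * x + b2 * y = p" if "Z $ 3 = 0"
      unfolding dist_norm norm_eq using that z
      by (simp add: inner_vec_def sum_3 x_def y_def d p_def power2_eq_square field_simps)
    moreover have "dist Z A = dist Z C \<longleftrightarrow> c1 * x + c2 * y = q" if "Z $ 3 = 0"
      unfolding dist_norm norm_eq using that z
      by (simp add: inner_vec_def sum_3 x_def y_def d q_def power2_eq_square field_simps)
    moreover have "b1 * x + b2 * y = p \<and> c1 * x + c2 * y = q \<longleftrightarrow>
        x = (p * c2 - q * b2) / k \<and> y = (q * b1 - p * c1) / k"
    proof
      assume "b1 * x + b2 * y = p \<and> c1 * x + c2 * y = q"
      then have "x * k = p * c2 - q * b2" "y * k = q * b1 - p * c1"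
        by (auto simp: k_def algebra_simps)
      then show "x = (p * c2 - q * b2) / k \<and> y = (q * b1 - p * c1) / k"
        using k by (simp add: eq_divide_eq)
    next
      assume "x = (p * c2 - q * b2) / k \<and> y = (q * b1 - p * c1) / k"
      then have "x * k = p * c2 - q * b2" "y * k = q * b1 - p * c1"
        using k by simp_all
      then have "(b1 * x + b2 * y) * k = p * k" "(c1 * x + c2 * y) * k = q * k"
        unfolding k_def by algebra+
      then show "b1 * x + b2 * y = p \<and> c1 * x + c2 * y = q" using k by simp
    qed
    ultimately show ?thesis unfolding x_def y_def Pi0_def by blast
  qed
  show ?thesis
  proof (rule ex1I[where a = "vector [A $ 1 + (p * c2 - q * b2) / k, A $ 2 + (q * b1 - p * c1) / k, 0]"])
    fix Z :: "real^3"
    assume "Z \<in> Pi0 \<and> dist Z A = dist Z B \<and> dist Z A = dist Z C"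
    then show "Z = vector [A $ 1 + (p * c2 - q * b2) / k, A $ 2 + (q * b1 - p * c1) / k, 0]"
      unfolding eq by (simp add: vec_eq_iff forall_3)
  qed (simp add: eq)
qed

end

theory Submission
  imports Defs
begin

text \<open>Degeneracy yields a direction \<open>h \<noteq> 0\<close> along which all three cosines are stationary.  Put
  \<open>a = A - D\<close>, \<open>b = B - D\<close>, \<open>c = C - D\<close> and \<open>x = h \<bullet> a / \<bar>a\<bar>\<^sup>2\<close>, and likewise \<open>y\<close>, \<open>z\<close>.  Stationarity of
  the cosine of the angle between \<open>a\<close> and \<open>b\<close> reads \<open>x (a \<bullet> (a - b)) + y (b \<bullet> (b - a)) = 0\<close>.  Off the
  plane \<open>a\<close>, \<open>b\<close>, \<open>c\<close> are independent, so \<open>(x, y, z) \<noteq> 0\<close> and the determinant of the three equations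
  vanishes.  As \<open>a - b\<close> etc. lie in the plane, this determinant depends only on the projection \<open>P\<close> of
  \<open>D\<close>; its cubic terms in \<open>P\<close> cancel, and what remains is a nonzero multiple of the power of \<open>P\<close> with
  respect to the circumcircle.\<close>

text \<open>The quotient rule gives a longer formula. It is regrouped by
  \<open>a \<bullet> (a - b) = (norm a)\<^sup>2 - a \<bullet> b\<close> so that \<open>h\<close>
  enters only through the scaled components that serve as unknowns of the linear system.\<close>

lemma has_derivative_cos_angle:
  fixes P R D :: "real^3"
  assumes "D \<noteq> P" "D \<noteq> R"
  defines "a \<equiv> P - D" and "b \<equiv> R - D"
  shows "((\<lambda>X. cos (angle P X R)) has_derivative
     (\<lambda>h. - ((h \<bullet> a) / (norm a)\<^sup>2 * (a \<bullet> (a - b)) + (h \<bullet> b) / (norm b)\<^sup>2 * (b \<bullet> (b - a)))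
        / (norm a * norm b))) (at D)"
proof -
  have nz: "a \<noteq> 0" "b \<noteq> 0" using assms by auto
  have n: "((\<lambda>X. norm (Q - X)) has_derivative (\<lambda>h. - (h \<bullet> (Q - D)) / norm (Q - D))) (at D)"
    if "Q - D \<noteq> 0" for Q :: "real^3"
  proof -
    have "((\<lambda>X. norm (Q - X)) has_derivative (\<lambda>h. (0 - h) \<bullet> sgn (Q - D))) (at D)"
      using that
      by (intro has_derivative_compose[of "\<lambda>X. Q - X" _ _ _ norm] has_derivative_norm
          derivative_intros)
    then show ?thesis
      by (simp add: sgn_div_norm inner_commute divide_inverse mult.commute)
  qed
  have i: "((\<lambda>X. (P - X) \<bullet> (R - X)) has_derivative (\<lambda>h. - (h \<bullet> a) - h \<bullet> b)) (at D)"
    by (auto intro!: derivative_eq_intros simp: a_def b_def inner_commute)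
  have "((\<lambda>X. cos (angle P X R)) has_derivative
     (\<lambda>h. ((- (h \<bullet> a) - h \<bullet> b) * (norm a * norm b) -
        (a \<bullet> b) * (norm a * (- (h \<bullet> b) / norm b) + - (h \<bullet> a) / norm a * norm b))
        / ((norm a * norm b) * (norm a * norm b)))) (at D)"
    unfolding cos_angle
    using has_derivative_divide'[OF i has_derivative_mult[OF n n]] nz
    by (simp add: a_def b_def)
  moreover have "((- s - t) * (norm a * norm b) -
        (a \<bullet> b) * (norm a * (- t / norm b) + - s / norm a * norm b))
        / ((norm a * norm b) * (norm a * norm b)) =
      - (s / (norm a)\<^sup>2 * (a \<bullet> (a - b)) + t / (norm b)\<^sup>2 * (b \<bullet> (b - a))) / (norm a * norm b)"
    for s t
  proof -
    have inner: "a \<bullet> (a - b) = (norm a)\<^sup>2 - a \<bullet> b" "b \<bullet> (b - a) = (norm b)\<^sup>2 - a \<bullet> b"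
      by (simp_all add: inner_diff_right power2_norm_eq_inner inner_commute)
    show ?thesis
      unfolding inner using nz by (simp add: field_simps power2_eq_square)
  qed
  ultimately show ?thesis by simp
qed

lemma stationary_cos_angle:
  fixes P R D h :: "real^3"
  assumes "D \<noteq> P" "D \<noteq> R"
    and "gradient (\<lambda>X. cos (angle P X R)) D \<bullet> h = 0"
  shows "(h \<bullet> (P - D)) / (norm (P - D))\<^sup>2 * ((P - D) \<bullet> (P - R)) +
    (h \<bullet> (R - D)) / (norm (R - D))\<^sup>2 * ((R - D) \<bullet> (R - P)) = 0"
proof -
  note d = has_derivative_cos_angle[OF assms(1,2)]
  then have "GDERIV (\<lambda>X. cos (angle P X R)) D :> gradient (\<lambda>X. cos (angle P X R)) D"
    by (intro GDERIV_gradient differentiableI)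
  from has_derivative_unique[OF d this[unfolded gderiv_def], THEN fun_cong, of h] assms
  show ?thesis by (auto simp: inner_commute)
qed

text \<open>The gradients span a proper subspace of a 3-dimensional space, so some nonzero vector is
  orthogonal to all of them.\<close>

lemma degenerate_direction:
  assumes "degenerate_for_F A B C D"
  obtains h where "h \<noteq> 0"
    "gradient (\<lambda>X. cos (angle B X C)) D \<bullet> h = 0"
    "gradient (\<lambda>X. cos (angle A X C)) D \<bullet> h = 0"
    "gradient (\<lambda>X. cos (angle A X B)) D \<bullet> h = 0"
proof -
  let ?S = "{gradient (\<lambda>X. cos (angle B X C)) D, gradient (\<lambda>X. cos (angle A X C)) D,
    gradient (\<lambda>X. cos (angle A X B)) D}"
  have "dim ?S \<noteq> 3"
    using assms by (simp add: degenerate_for_F_def F_def)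
  then have "dim ?S < DIM(real^3)"
    using dim_subset_UNIV[of ?S] by simp
  then obtain h where "h \<noteq> 0" "\<And>y. y \<in> span ?S \<Longrightarrow> orthogonal h y"
    using orthogonal_to_subspace_exists by metis
  then show thesis
    by (intro that[of h]) (auto intro: span_base simp: orthogonal_def inner_commute[of _ h])
qed

text \<open>The expression is the determinant of the cyclic coefficient matrix. By Cramer's rule its
  product with each unknown is a combination of the equations.\<close>

lemma cyclic_system_det:
  fixes x y z :: real
  assumes "x * p1 + y * p2 = 0" "y * q1 + z * q2 = 0" "z * r1 + x * r2 = 0"
    and "x \<noteq> 0 \<or> y \<noteq> 0 \<or> z \<noteq> 0"
  shows "p1 * q1 * r1 + p2 * q2 * r2 = 0"
proof -
  let ?d = "p1 * q1 * r1 + p2 * q2 * r2"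
  have "x * ?d = 0" "y * ?d = 0" "z * ?d = 0"
    using assms(1-3) by algebra+
  then show ?thesis using assms(4) by auto
qed

lemma cross_nonzero_if_not_collinear:
  fixes A B C :: "real^3"
  assumes "A \<in> Pi0" "B \<in> Pi0" "C \<in> Pi0" "\<not> collinear {A, B, C}"
  shows "(B $ 1 - A $ 1) * (C $ 2 - A $ 2) - (B $ 2 - A $ 2) * (C $ 1 - A $ 1) \<noteq> 0"
    (is "?k \<noteq> 0")
proof
  assume k: "?k = 0"
  obtain Z where Z: "Z \<in> Pi0" "dist Z A = dist Z B" "dist Z A = dist Z C"
    and uniq: "\<And>Y. Y \<in> Pi0 \<Longrightarrow> dist Y A = dist Y B \<Longrightarrow> dist Y A = dist Y C \<Longrightarrow> Y = Z"
    using circumcenter_ex1[OF assms] by metis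
  have z: "A $ 3 = 0" "B $ 3 = 0" "C $ 3 = 0" using assms by (auto simp: Pi0_def)
  \<comment> \<open>a planar vector normal to both sides could be added to the circumcenter\<close>
  have no: "n = 0" if "n $ 3 = 0" "n \<bullet> (B - A) = 0" "n \<bullet> (C - A) = 0" for n :: "real^3"
  proof -
    have eq: "dist (Z + n) A = dist (Z + n) Q" if "dist Z A = dist Z Q" "n \<bullet> (Q - A) = 0" for Q
      using that unfolding dist_norm norm_eq
      by (simp add: inner_diff_left inner_diff_right inner_add_left inner_add_right inner_commute)
    have "Z + n = Z"
      using Z that by (intro uniq eq) (simp_all add: Pi0_def)
    then show ?thesis by simp
  qed
  \<comment> \<open>The witness is \<open>B - A\<close> turned by a right angle; its inner product
    with \<open>C - A\<close> is the expression assumed to vanish in \<open>k\<close>.\<close>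
  have "B = A"
    using no[of "vector [- (B $ 2 - A $ 2), B $ 1 - A $ 1, 0]"] k z
    by (simp add: inner_vec_def sum_3 vec_eq_iff forall_3 algebra_simps)
  then show False using assms(4) by simp
qed

text \<open>Planar coordinates with \<open>A\<close> as origin: b and c are the other vertices, (x,
  y) is the projection of \<open>D\<close>, and z is the circumcenter, equidistant from 0, b and c.
  The circle passes through the origin, so the last factor is |P - z|^2 - |z|^2, the power of P =
  (x, y).\<close>

lemma det_eq_cross_times_power:
  fixes b1 b2 c1 c2 x y z1 z2 :: real
  defines "k \<equiv> b1 * c2 - b2 * c1"
  assumes "2 * (b1 * z1 + b2 * z2) = b1\<^sup>2 + b2\<^sup>2" "2 * (c1 * z1 + c2 * z2) = c1\<^sup>2 + c2\<^sup>2"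
  shows "(x * b1 + y * b2) * ((b1 - x) * (b1 - c1) + (b2 - y) * (b2 - c2)) *
           ((c1 - x) * c1 + (c2 - y) * c2) +
         ((b1 - x) * b1 + (b2 - y) * b2) * ((c1 - x) * (c1 - b1) + (c2 - y) * (c2 - b2)) *
           (x * c1 + y * c2) =
         - k\<^sup>2 * (x\<^sup>2 + y\<^sup>2 - 2 * (x * z1 + y * z2))"
  using assms(2,3) unfolding k_def by algebra

theorem proposition4:
  fixes A B C D :: "real^3"
  assumes "A \<in> Pi0" and "B \<in> Pi0" and "C \<in> Pi0"
    and "\<not> collinear {A, B, C}"
    and "D \<notin> {A, B, C}"
    and "degenerate_for_F A B C D"
  shows "D \<in> Pi0 \<or> D \<in> Cyl A B C"
proof (cases "D \<in> Pi0")
  case False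
  then have d: "D $ 3 \<noteq> 0" by (simp add: Pi0_def)
  have z: "A $ 3 = 0" "B $ 3 = 0" "C $ 3 = 0" using assms by (auto simp: Pi0_def)
  have ne: "D \<noteq> A" "D \<noteq> B" "D \<noteq> C" using assms by auto
  note k = cross_nonzero_if_not_collinear[OF assms(1-4)]
  obtain h where h: "h \<noteq> 0"
    "gradient (\<lambda>X. cos (angle B X C)) D \<bullet> h = 0"
    "gradient (\<lambda>X. cos (angle A X C)) D \<bullet> h = 0"
    "gradient (\<lambda>X. cos (angle A X B)) D \<bullet> h = 0"
    using degenerate_direction[OF assms(6)] .
  \<comment> \<open>Otherwise \<open>h\<close> is orthogonal to two independent sides, hence
    vertical, and the height of \<open>D\<close> then forces \<open>h = 0\<close>.\<close>
  have "h \<bullet> (A - D) \<noteq> 0 \<or> h \<bullet> (B - D) \<noteq> 0 \<or> h \<bullet> (C - D) \<noteq> 0"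
  proof (rule ccontr)
    assume "\<not> ?thesis"
    then have 0: "h \<bullet> (A - D) = 0" "h \<bullet> (B - A) = 0" "h \<bullet> (C - A) = 0"
      by (auto simp: inner_diff_right)
    then have "h $ 1 * (B $ 1 - A $ 1) + h $ 2 * (B $ 2 - A $ 2) = 0"
      "h $ 1 * (C $ 1 - A $ 1) + h $ 2 * (C $ 2 - A $ 2) = 0"
      using z by (simp_all add: inner_vec_def sum_3)
    then have "h $ 1 * ((B $ 1 - A $ 1) * (C $ 2 - A $ 2) - (B $ 2 - A $ 2) * (C $ 1 - A $ 1)) = 0"
      "h $ 2 * ((B $ 1 - A $ 1) * (C $ 2 - A $ 2) - (B $ 2 - A $ 2) * (C $ 1 - A $ 1)) = 0"
      by algebra+
    then have "h $ 1 = 0" "h $ 2 = 0" using k by simp_all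
    moreover from this have "h $ 3 = 0"
      using 0(1) z d by (simp add: inner_vec_def sum_3)
    ultimately show False using h(1) by (simp add: vec_eq_iff forall_3)
  qed
  then have nz: "(h \<bullet> (A - D)) / (norm (A - D))\<^sup>2 \<noteq> 0 \<or> (h \<bullet> (B - D)) / (norm (B - D))\<^sup>2 \<noteq> 0 \<or>
      (h \<bullet> (C - D)) / (norm (C - D))\<^sup>2 \<noteq> 0"
    using ne by auto
  \<comment> \<open>The pairs are taken in the cyclic order AB, BC, CA, so the summands of the third
    equation are swapped.\<close>
  have det: "((A - D) \<bullet> (A - B)) * ((B - D) \<bullet> (B - C)) * ((C - D) \<bullet> (C - A)) +
      ((B - D) \<bullet> (B - A)) * ((C - D) \<bullet> (C - B)) * ((A - D) \<bullet> (A - C)) = 0"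
    using stationary_cos_angle[OF ne(1,2) h(4)] stationary_cos_angle[OF ne(2,3) h(2)]
      stationary_cos_angle[OF ne(1,3) h(3), unfolded add.commute[of "_ * ((A - D) \<bullet> _)"]] nz
    by (rule cyclic_system_det)

  define Z where "Z = circumcenter A B C"
  have Z: "Z $ 3 = 0" "dist Z A = dist Z B" "dist Z A = dist Z C"
    using theI'[OF circumcenter_ex1[OF assms(1-4)]]
    by (auto simp: Z_def circumcenter_def Pi0_def)
  define b1 b2 c1 c2 x y z1 z2 where
    "b1 = B $ 1 - A $ 1" and "b2 = B $ 2 - A $ 2" and "c1 = C $ 1 - A $ 1" and "c2 = C $ 2 - A $ 2"
    and "x = D $ 1 - A $ 1" and "y = D $ 2 - A $ 2" and "z1 = Z $ 1 - A $ 1" and "z2 = Z $ 2 - A $ 2"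
  note defs = b1_def b2_def c1_def c2_def x_def y_def z1_def z2_def
  have zb: "2 * (b1 * z1 + b2 * z2) = b1\<^sup>2 + b2\<^sup>2"
    using Z(1,2) z unfolding dist_norm norm_eq
    by (simp add: inner_vec_def sum_3 defs power2_eq_square algebra_simps)
  have zc: "2 * (c1 * z1 + c2 * z2) = c1\<^sup>2 + c2\<^sup>2"
    using Z(1,3) z unfolding dist_norm norm_eq
    by (simp add: inner_vec_def sum_3 defs power2_eq_square algebra_simps)
  \<comment> \<open>The sides are horizontal, so the height of \<open>D\<close> drops out.\<close>
  have inner:
    "(A - D) \<bullet> (A - B) = x * b1 + y * b2"
    "(B - D) \<bullet> (B - C) = (b1 - x) * (b1 - c1) + (b2 - y) * (b2 - c2)"
    "(C - D) \<bullet> (C - A) = (c1 - x) * c1 + (c2 - y) * c2"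
    "(B - D) \<bullet> (B - A) = (b1 - x) * b1 + (b2 - y) * b2"
    "(C - D) \<bullet> (C - B) = (c1 - x) * (c1 - b1) + (c2 - y) * (c2 - b2)"
    "(A - D) \<bullet> (A - C) = x * c1 + y * c2"
    using z by (simp_all add: inner_vec_def sum_3 defs algebra_simps)
  have pow: "x\<^sup>2 + y\<^sup>2 = 2 * (x * z1 + y * z2)"
    using det[unfolded inner det_eq_cross_times_power[OF zb zc]] k by (simp add: defs)
  \<comment> \<open>The foot of the perpendicular from \<open>D\<close>; by \<open>pow\<close> it
    has power zero, so it lies on the circle.\<close>
  define X :: "real^3" where "X = vector [D $ 1, D $ 2, 0]"
  have "dist Z X = dist Z A"
    using pow Z(1) z unfolding dist_norm norm_eq
    by (simp add: X_def inner_vec_def sum_3 defs power2_eq_square algebra_simps)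
  then have "X \<in> circumcircle A B C"
    by (simp add: circumcircle_def Z_def Pi0_def X_def)
  moreover have "D = X + D $ 3 *\<^sub>R axis 3 1"
    by (simp add: X_def vec_eq_iff forall_3 axis_def)
  ultimately show ?thesis
    unfolding Cyl_def by blast
qed simp

end
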